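(* Let $A\in\mathbb{R}^{n\times n}$ be nonsingular, $B\in\mathbb{R}^{n\times \ell}$ and $C\in\mathbb{R}^{s\times n}$ of full rank, with $\ell,s\ll n$, let $T_f>0$ and $X_0\in\mathbb{R}^{n\times n}$. Let $X$ be the exact solution on $[0,T_f]$ of the differential Riccati equation $$\dot X(t)=A^TX(t)+X(t)A-X(t)BB^TX(t)+C^TC,\qquad X(0)=X_0.$$ Let $m\ge1$ and let $X_m=\mathcal V_mY_m\mathcal V_m^T$ be the approximate solution obtained at step $m$ of the extended block Arnoldi projection method, i.e. $\mathcal V_m\in\mathbb{R}^{n\times 2ms}$ is the matrix with orthonormal columns produced by $m$ steps (without breakdown) of the extended block Arnoldi process applied to $(A^T,C^T)$, and $Y_m:[0,T_f]\to\mathbb{R}^{2ms\times 2ms}$ is a differentiable solution of $$\dot Y_m-\mathcal T_mY_m-Y_m\mathcal T_m^T+Y_mB_mB_m^TY_m-C_m^TC_m=0,$$ with $\mathcal T_m=\mathcal V_m^TA^T\mathcal V_m$, $B_m=\mathcal V_m^TB$, $C_m=C\mathcal V_m$. Then the error $\mathcal{E}_m=X-X_m$ satisfies on $[0,T_f]$ $$\dot{\mathcal{E}}_m=(A^T-XBB^T)\mathcal{E}_m+\mathcal{E}_m(A-BB^TX)+\mathcal{E}_mBB^T\mathcal{E}_m-R_m,$$ where $R_m$ is the residual $$R_m=\dot X_m-A^TX_m-X_mA+X_mBB^TX_m-C^TC.$$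
   Context: Extended block Arnoldi process applied to $(A^T,C^T)$. Compute the QR decomposition $[C^T,A^{-T}C^T]=V_1\Lambda$ with $V_1\in\mathbb{R}^{n\times 2s}$ having orthonormal columns. For $j=1,\dots,m$: let $V_j^{(1)}$ and $V_j^{(2)}$ be the first $s$ and the last $s$ columns of $V_j$; set $\hat V_{j+1}=[A^TV_j^{(1)},A^{-T}V_j^{(2)}]$; for $i=1,\dots,j$ set $H_{i,j}=V_i^T\hat V_{j+1}$ and replace $\hat V_{j+1}$ by $\hat V_{j+1}-V_iH_{i,j}$; then compute the QR decomposition $\hat V_{j+1}=V_{j+1}H_{j+1,j}$ with $V_{j+1}\in\mathbb{R}^{n\times 2s}$. "Without breakdown" means that $[C^T,A^{-T}C^T]$ has full column rank and no upper triangular matrix $H_{j+1,j}$, $1\le j\le m$, is rank deficient; then $\mathcal V_m=[V_1,\dots,V_m]$ has orthonormal columns. *)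

theory Defs
  imports "HOL-Analysis.Derivative" "Jordan_Normal_Form.DL_Rank"
    "Jordan_Normal_Form.Gauss_Jordan_Elimination"
begin

definition full_rank :: "real mat \<Rightarrow> bool" where
  "full_rank M \<longleftrightarrow> vec_space.rank (dim_row M) M = min (dim_row M) (dim_col M)"

definition hcat :: "real mat \<Rightarrow> real mat \<Rightarrow> real mat" where
  "hcat M N = mat_of_cols (dim_row M) (cols M @ cols N)"

definition first_cols :: "nat \<Rightarrow> real mat \<Rightarrow> real mat" where
  "first_cols k M = mat_of_cols (dim_row M) (take k (cols M))"

definition last_cols :: "nat \<Rightarrow> real mat \<Rightarrow> real mat" where
  "last_cols k M = mat_of_cols (dim_row M) (drop (dim_col M - k) (cols M))"

text \<open>Reduced QR decomposition: \<open>Q\<close> has the shape of \<open>M\<close>, and \<open>R\<close> is square.\<close>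

definition qr_decomposition :: "real mat \<Rightarrow> real mat \<Rightarrow> real mat \<Rightarrow> bool" where
  "qr_decomposition M Q R \<longleftrightarrow>
     Q \<in> carrier_mat (dim_row M) (dim_col M) \<and> Q\<^sup>T * Q = 1\<^sub>m (dim_col M) \<and>
     R \<in> carrier_mat (dim_col M) (dim_col M) \<and> upper_triangular R \<and> M = Q * R"

text \<open>\<open>mgs V W i\<close> is the block \<open>W\<close> after it has been updated successively against
  \<open>V 1, \<dots>, V i\<close>.\<close>

primrec mgs :: "(nat \<Rightarrow> real mat) \<Rightarrow> real mat \<Rightarrow> nat \<Rightarrow> real mat" where
  "mgs V W 0 = W"
| "mgs V W (Suc i) = mgs V W i - V (Suc i) * ((V (Suc i))\<^sup>T * mgs V W i)"

text \<open>The process for a nonsingular matrix \<open>F\<close> and a starting block \<open>G\<close> with \<open>s\<close> columns.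
  It is a relation since a QR decomposition is not unique. As the update of the candidate block
  is sequential, \<open>H i j\<close> is computed from the block already updated against
  \<open>V 1, \<dots>, V (i - 1)\<close>.\<close>

definition arnoldi_start :: "real mat \<Rightarrow> real mat \<Rightarrow> real mat" where
  "arnoldi_start F G = hcat G (the (mat_inverse F) * G)"

definition arnoldi_candidate :: "real mat \<Rightarrow> nat \<Rightarrow> real mat \<Rightarrow> real mat" where
  "arnoldi_candidate F s W = hcat (F * first_cols s W) (the (mat_inverse F) * last_cols s W)"

definition extended_block_arnoldi ::
  "real mat \<Rightarrow> real mat \<Rightarrow> nat \<Rightarrow> (nat \<Rightarrow> real mat) \<Rightarrow> real mat \<Rightarrow> (nat \<Rightarrow> nat \<Rightarrow> real mat) \<Rightarrow> bool"
where
  "extended_block_arnoldi F G m V \<Lambda> H \<longleftrightarrow>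
     qr_decomposition (arnoldi_start F G) (V 1) \<Lambda> \<and>
     (\<forall>j\<in>{1..m}.
        let W = arnoldi_candidate F (dim_col G) (V j) in
          (\<forall>i\<in>{1..j}. H i j = (V i)\<^sup>T * mgs V W (i - 1)) \<and>
          qr_decomposition (mgs V W j) (V (j + 1)) (H (j + 1) j))"

definition without_breakdown ::
  "real mat \<Rightarrow> real mat \<Rightarrow> nat \<Rightarrow> (nat \<Rightarrow> nat \<Rightarrow> real mat) \<Rightarrow> bool" where
  "without_breakdown F G m H \<longleftrightarrow>
     vec_space.rank (dim_row G) (arnoldi_start F G) = dim_col (arnoldi_start F G) \<and>
     (\<forall>j\<in>{1..m}. full_rank (H (j + 1) j))"

definition arnoldi_basis :: "nat \<Rightarrow> nat \<Rightarrow> (nat \<Rightarrow> real mat) \<Rightarrow> real mat" where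
  "arnoldi_basis n m V = mat_of_cols n (concat (map (\<lambda>j. cols (V j)) [1..<m + 1]))"

text \<open>Matrices of this type carry no topology, so matrix-valued functions are differentiated
  entrywise; their dimensions must be constant on the set considered.\<close>

definition has_mat_derivative ::
  "(real \<Rightarrow> real mat) \<Rightarrow> real mat \<Rightarrow> real \<Rightarrow> real set \<Rightarrow> bool" where
  "has_mat_derivative F D t S \<longleftrightarrow>
     (\<forall>\<tau>\<in>S. F \<tau> \<in> carrier_mat (dim_row D) (dim_col D)) \<and>
     (\<forall>i<dim_row D. \<forall>j<dim_col D.
        ((\<lambda>\<tau>. F \<tau> $$ (i, j)) has_real_derivative D $$ (i, j)) (at t within S))"

definition mat_differentiable :: "(real \<Rightarrow> real mat) \<Rightarrow> real \<Rightarrow> real set \<Rightarrow> bool" where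
  "mat_differentiable F t S \<longleftrightarrow> (\<exists>D. has_mat_derivative F D t S)"

definition mat_derivative :: "(real \<Rightarrow> real mat) \<Rightarrow> real \<Rightarrow> real set \<Rightarrow> real mat" where
  "mat_derivative F t S = mat (dim_row (F t)) (dim_col (F t))
     (\<lambda>(i, j). vector_derivative (\<lambda>\<tau>. F \<tau> $$ (i, j)) (at t within S))"

end

theory Submission
  imports Defs
begin

text \<open>Solving the definition of the residual for \<open>Xm'\<close> and subtracting from the equation for
  \<open>X\<close> cancels \<open>C\<^sup>T C\<close> and leaves the quadratic difference \<open>X S X - Xm S Xm\<close> with
  \<open>S = B B\<^sup>T\<close>, which equals \<open>X S E + E S X - E S E\<close> for \<open>E = X - Xm\<close>. The shape of the
  Arnoldi basis makes \<open>Xm\<close> inherit differentiability from \<open>Y\<close>, so that the derivative in the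
  residual is a genuine one.\<close>

lemma arnoldi_start_carrier:
  assumes "G \<in> carrier_mat n s"
  shows "arnoldi_start F G \<in> carrier_mat n (2 * s)"
  using assms unfolding arnoldi_start_def hcat_def by (auto intro!: carrier_matI)

lemma arnoldi_candidate_carrier:
  assumes "F \<in> carrier_mat n n" "W \<in> carrier_mat n (2 * s)"
  shows "arnoldi_candidate F s W \<in> carrier_mat n (2 * s)"
  using assms unfolding arnoldi_candidate_def hcat_def first_cols_def last_cols_def
  by (auto intro!: carrier_matI)

lemma mgs_carrier:
  assumes "W \<in> carrier_mat n k" "\<And>i. 1 \<le> i \<Longrightarrow> i \<le> j \<Longrightarrow> V i \<in> carrier_mat n k"
  shows "mgs V W j \<in> carrier_mat n k"
  using assms(2)
proof (induction j)
  case (Suc j)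
  have V: "V (Suc j) \<in> carrier_mat n k"
    by (rule Suc.prems) simp_all
  have "mgs V W j \<in> carrier_mat n k"
    by (rule Suc.IH) (rule Suc.prems, simp_all)
  with V have "(V (Suc j))\<^sup>T * mgs V W j \<in> carrier_mat k k"
    by (intro mult_carrier_mat transpose_carrier_mat[THEN iffD2])
  with V have "V (Suc j) * ((V (Suc j))\<^sup>T * mgs V W j) \<in> carrier_mat n k"
    by (rule mult_carrier_mat)
  then show ?case
    by (simp add: minus_carrier_mat)
qed (simp add: assms(1))

lemma qr_decomposition_carrier:
  assumes "qr_decomposition M Q R" "M \<in> carrier_mat n k"
  shows "Q \<in> carrier_mat n k"
  using assms(1)[unfolded qr_decomposition_def, THEN conjunct1] carrier_matD[OF assms(2)]
  by (simp only:)

text \<open>A reduced QR factor \<open>Q\<close> has the shape of the matrix it factors, so shapes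
  propagate from block to block. The induction is strong because the candidate for block
  \<open>k + 1\<close> is updated against all of \<open>V 1\<close>, ..., \<open>V k\<close>. The
  bound \<open>m + 1\<close> covers the block produced in the last pass.\<close>

lemma extended_block_arnoldi_carrier:
  assumes F: "F \<in> carrier_mat n n" and G: "G \<in> carrier_mat n s"
    and arn: "extended_block_arnoldi F G m V \<Lambda> H"
    and j: "1 \<le> j" "j \<le> m + 1"
  shows "V j \<in> carrier_mat n (2 * s)"
  using j
proof (induction j rule: less_induct)
  case (less j)
  show ?case
  proof (cases "j = 1")
    case True
    have "qr_decomposition (arnoldi_start F G) (V 1) \<Lambda>"
      using arn unfolding extended_block_arnoldi_def by (rule conjunct1)
    from this arnoldi_start_carrier[OF G] show ?thesis
      unfolding True by (rule qr_decomposition_carrier)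
  next
    case False
    define k where "k = j - 1"
    with False less.prems have k: "j = k + 1" "1 \<le> k" "k \<le> m" by simp_all
    let ?W = "arnoldi_candidate F (dim_col G) (V k)"
    have IH: "V i \<in> carrier_mat n (2 * s)" if "1 \<le> i" "i \<le> k" for i
      by (rule less.IH) (use that k in simp_all)
    have "?W \<in> carrier_mat n (2 * s)"
      unfolding carrier_matD(2)[OF G]
      by (rule arnoldi_candidate_carrier[OF F IH[OF k(2) order.refl]])
    then have "mgs V ?W k \<in> carrier_mat n (2 * s)"
      using IH by (rule mgs_carrier)
    moreover have "qr_decomposition (mgs V ?W k) (V (k + 1)) (H (k + 1) k)"
      using arn k(2,3) unfolding extended_block_arnoldi_def Let_def
      by (metis atLeastAtMost_iff)
    ultimately show ?thesis
      unfolding k(1) by (rule qr_decomposition_carrier[rotated])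
  qed
qed

lemma arnoldi_basis_carrier:
  assumes "\<And>j. 1 \<le> j \<Longrightarrow> j \<le> m \<Longrightarrow> V j \<in> carrier_mat n k"
  shows "arnoldi_basis n m V \<in> carrier_mat n (m * k)"
proof -
  have "length (cols (V j)) = k" if "j \<in> set [1..<m + 1]" for j
    using that by (auto intro: carrier_matD(2)[OF assms])
  then have "map (\<lambda>j. length (cols (V j))) [1..<m + 1] = map (\<lambda>_. k) [1..<m + 1]"
    by (rule map_cong[OF refl])
  also have "\<dots> = replicate m k"
    by (simp add: map_replicate_const)
  finally have "map (\<lambda>j. length (cols (V j))) [1..<m + 1] = replicate m k" .
  \<comment> \<open>Removing \<open>upt_Suc\<close> keeps the range from being split at its last
    element, so the goal matches the equation just derived.\<close>
  then have "length (concat (map (\<lambda>j. cols (V j)) [1..<m + 1])) = m * k"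
    by (simp add: length_concat comp_def sum_list_replicate del: upt_Suc)
  then show ?thesis
    unfolding arnoldi_basis_def by (auto intro!: carrier_matI)
qed

lemma has_mat_derivative_minus:
  assumes "has_mat_derivative F D t S" "has_mat_derivative G D' t S"
    and "t \<in> S" "D \<in> carrier_mat p q" "D' \<in> carrier_mat p q"
  shows "has_mat_derivative (\<lambda>\<tau>. F \<tau> - G \<tau>) (D - D') t S"
  unfolding has_mat_derivative_def
proof (intro conjI ballI allI impI)
  fix \<tau> assume "\<tau> \<in> S"
  then show "F \<tau> - G \<tau> \<in> carrier_mat (dim_row (D - D')) (dim_col (D - D'))"
    using assms unfolding has_mat_derivative_def by (auto intro: minus_carrier_mat)
next
  fix i j assume ij: "i < dim_row (D - D')" "j < dim_col (D - D')"
  have "((\<lambda>\<tau>. F \<tau> $$ (i, j) - G \<tau> $$ (i, j)) has_real_derivative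
      D $$ (i, j) - D' $$ (i, j)) (at t within S)"
    using assms ij unfolding has_mat_derivative_def by (intro derivative_intros) auto
  \<comment> \<open>An entry of the difference is the difference of entries only where the
    dimensions are known, that is on \<open>S\<close>. Agreement near \<open>t\<close> within
    \<open>S\<close> and at \<open>t\<close> itself suffices to exchange the two functions.\<close>
  then show "((\<lambda>\<tau>. (F \<tau> - G \<tau>) $$ (i, j)) has_real_derivative (D - D') $$ (i, j)) (at t within S)"
    using assms ij
    by (subst has_field_derivative_cong_eventually[where g = "\<lambda>\<tau>. F \<tau> $$ (i, j) - G \<tau> $$ (i, j)"])
      (auto simp: has_mat_derivative_def eventually_at_filter intro!: always_eventually)
qed

text \<open>Since \<open>M\<close> is constant, each entry of the product is a fixed linear
  combination of the entries of \<open>F\<close>. This is what differentiates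
  \<open>Vm * Y t * Vm\<^sup>T\<close>.\<close>

lemma has_mat_derivative_congruence:
  assumes F: "has_mat_derivative F D t S" and t: "t \<in> S"
    and D: "D \<in> carrier_mat k k" and M: "M \<in> carrier_mat n k"
  shows "has_mat_derivative (\<lambda>\<tau>. M * F \<tau> * M\<^sup>T) (M * D * M\<^sup>T) t S"
proof -
  have entry: "(M * P * M\<^sup>T) $$ (i, j) = (\<Sum>b<k. (\<Sum>a<k. M $$ (i, a) * P $$ (a, b)) * M $$ (j, b))"
    if "P \<in> carrier_mat k k" "i < n" "j < n" for P i j
    using that M
    by (simp add: assoc_mult_mat[of M n k P k "M\<^sup>T" n] scalar_prod_def atLeast0LessThan
        sum_distrib_left sum_distrib_right mult.assoc)
      (rule sum.swap)
  have dim: "F \<tau> \<in> carrier_mat k k" if "\<tau> \<in> S" for \<tau>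
    using F D that unfolding has_mat_derivative_def by auto
  show ?thesis
    unfolding has_mat_derivative_def
  proof (intro conjI ballI allI impI)
    fix \<tau> assume "\<tau> \<in> S"
    then show "M * F \<tau> * M\<^sup>T \<in> carrier_mat (dim_row (M * D * M\<^sup>T)) (dim_col (M * D * M\<^sup>T))"
      by auto
  next
    fix i j assume "i < dim_row (M * D * M\<^sup>T)" "j < dim_col (M * D * M\<^sup>T)"
    with M have ij: "i < n" "j < n" by auto
    have "((\<lambda>\<tau>. \<Sum>b<k. (\<Sum>a<k. M $$ (i, a) * F \<tau> $$ (a, b)) * M $$ (j, b)) has_real_derivative
        (\<Sum>b<k. (\<Sum>a<k. M $$ (i, a) * D $$ (a, b)) * M $$ (j, b))) (at t within S)"
      using F D unfolding has_mat_derivative_def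
      by (intro DERIV_sum DERIV_cmult_right DERIV_cmult) auto
    then show "((\<lambda>\<tau>. (M * F \<tau> * M\<^sup>T) $$ (i, j)) has_real_derivative (M * D * M\<^sup>T) $$ (i, j))
        (at t within S)"
      unfolding entry[OF D ij]
      by (subst has_field_derivative_cong_eventually[where
            g = "\<lambda>\<tau>. \<Sum>b<k. (\<Sum>a<k. M $$ (i, a) * F \<tau> $$ (a, b)) * M $$ (j, b)"])
        (auto simp: eventually_at_filter entry[OF dim ij] t)
  qed
qed

text \<open>With \<open>a < b\<close> every point of the interval, endpoints included, is a limit
  point of it, so the derivative within the interval is unique and the choice in
  \<open>vector_derivative\<close> must return the entry of \<open>D\<close>.\<close>

lemma mat_derivative_eq:
  assumes "a < b" "t \<in> {a..b}" "has_mat_derivative F D t {a..b}"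
  shows "mat_derivative F t {a..b} = D"
proof -
  \<comment> \<open>\<open>mat_derivative\<close> takes its size from the value \<open>F t\<close>,
    which therefore has to be matched with that of \<open>D\<close>.\<close>
  have dim: "F t \<in> carrier_mat (dim_row D) (dim_col D)"
    using assms unfolding has_mat_derivative_def by blast
  have "vector_derivative (\<lambda>\<tau>. F \<tau> $$ (i, j)) (at t within {a..b}) = D $$ (i, j)"
    if "i < dim_row D" "j < dim_col D" for i j
    using assms that unfolding has_mat_derivative_def
    by (intro vector_derivative_within_closed_interval)
      (auto simp: has_real_derivative_iff_has_vector_derivative)
  with dim show ?thesis
    unfolding mat_derivative_def by (intro eq_matI) auto
qed

text \<open>Matrix algebra at a fixed time: \<open>Z\<close>, \<open>D\<close> and \<open>K\<close>
  stand for \<open>Xm t\<close>, its derivative and \<open>C\<^sup>T * C\<close>, so the last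
  bracket is the residual.\<close>

lemma riccati_error_identity:
  fixes X Z D K A B :: "real mat"
  assumes A: "A \<in> carrier_mat n n" and B: "B \<in> carrier_mat n l" and "X \<in> carrier_mat n n"
    "Z \<in> carrier_mat n n" "D \<in> carrier_mat n n" "K \<in> carrier_mat n n"
  shows "(A\<^sup>T * X + X * A - X * B * B\<^sup>T * X + K) - D =
    (A\<^sup>T - X * B * B\<^sup>T) * (X - Z) + (X - Z) * (A - B * B\<^sup>T * X) + (X - Z) * B * B\<^sup>T * (X - Z)
      - (D - A\<^sup>T * Z - Z * A + Z * B * B\<^sup>T * Z - K)"
proof -
  \<comment> \<open>Replacing the rectangular \<open>B\<close> by \<open>S\<close> makes all factors
    square of order \<open>n\<close>, so one carrier set serves every side condition.\<close>
  define S where "S = B * B\<^sup>T"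
  have S: "S \<in> carrier_mat n n" "A\<^sup>T \<in> carrier_mat n n"
    unfolding S_def using A B by auto
  have fold_S: "P * B * B\<^sup>T = P * S" if "P \<in> carrier_mat n n" for P
    unfolding S_def using that B by (intro assoc_mult_mat) auto
  \<comment> \<open>Used from left to right, these rules multiply out and associate to the right, so
    equal monomials become syntactically equal.\<close>
  have l: "(P - Q) * N = P * N - Q * N" "N * (P - Q) = N * P - N * Q"
    "P * Q * N = P * (Q * N)"
    if "P \<in> carrier_mat n n" "Q \<in> carrier_mat n n" "N \<in> carrier_mat n n" for P Q N :: "real mat"
    using minus_mult_distrib_mat[OF that] mult_minus_distrib_mat[OF that(3,1,2)]
      assoc_mult_mat[OF that] by simp_all
  have closed: "P * Q \<in> carrier_mat n n" "P - Q \<in> carrier_mat n n"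
    if "P \<in> carrier_mat n n" "Q \<in> carrier_mat n n" for P Q :: "real mat"
    using mult_carrier_mat[OF that] minus_carrier_mat[OF that(2)] by simp_all
  have expand:
    "(A\<^sup>T - X * S) * (X - Z) = (A\<^sup>T * X - X * (S * X)) - (A\<^sup>T * Z - X * (S * Z))"
    "(X - Z) * (A - S * X) = (X * A - Z * A) - (X * (S * X) - Z * (S * X))"
    "(X - Z) * S * (X - Z) = (X * (S * X) - Z * (S * X)) - (X * (S * Z) - Z * (S * Z))"
    "X * S * X = X * (S * X)" "Z * S * Z = Z * (S * Z)"
    by (simp_all only: l assms S closed)
  have fS: "X * B * B\<^sup>T = X * S" "Z * B * B\<^sup>T = Z * S" "(X - Z) * B * B\<^sup>T = (X - Z) * S"
    "B * B\<^sup>T = S"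
    by (simp_all only: fold_S assms closed S_def[symmetric])
  \<comment> \<open>Only additive cancellation is left, with each monomial as an atom:
    \<open>c\<close>, \<open>f\<close>, \<open>h\<close>, \<open>q\<close> are
    \<open>X * (S * X)\<close>, \<open>X * (S * Z)\<close>, \<open>Z * (S * X)\<close>,
    \<open>Z * (S * Z)\<close>. It is checked entrywise in the reals.\<close>
  have gen: "(a + b - c + k) - d = ((a - c) - (e - f)) + ((b - g) - (c - h)) + ((c - h) - (f - q))
      - (d - e - g + q - k)"
    if "a \<in> carrier_mat n n" "b \<in> carrier_mat n n" "c \<in> carrier_mat n n" "d \<in> carrier_mat n n"
      "e \<in> carrier_mat n n" "f \<in> carrier_mat n n" "g \<in> carrier_mat n n" "h \<in> carrier_mat n n"
      "q \<in> carrier_mat n n" "k \<in> carrier_mat n n" for a b c d e f g h q k :: "real mat"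
    by (rule eq_matI) (simp_all add: that[THEN carrier_matD(1)] that[THEN carrier_matD(2)])
  show ?thesis
    unfolding fS expand by (rule gen) (simp_all only: assms S closed)
qed

theorem theorem5:
  fixes n l s m :: nat
    and A B C X0 \<Lambda> Vm Tm Bm Cm :: "real mat"
    and T_f :: real
    and X Y Xm E R :: "real \<Rightarrow> real mat"
    and V :: "nat \<Rightarrow> real mat"
    and H :: "nat \<Rightarrow> nat \<Rightarrow> real mat"
  assumes A: "A \<in> carrier_mat n n" "invertible_mat A"
    and B: "B \<in> carrier_mat n l" "full_rank B"
    and C: "C \<in> carrier_mat s n" "full_rank C"
    and small: "l < n" "s < n"
    and T_f: "T_f > 0"
    and X0: "X0 \<in> carrier_mat n n"
    and X_dim: "\<And>t. t \<in> {0..T_f} \<Longrightarrow> X t \<in> carrier_mat n n"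
    and X_ode: "\<And>t. t \<in> {0..T_f} \<Longrightarrow>
      has_mat_derivative X (A\<^sup>T * X t + X t * A - X t * B * B\<^sup>T * X t + C\<^sup>T * C) t {0..T_f}"
    and X_init: "X 0 = X0"
    and m: "m \<ge> 1"
    and arnoldi: "extended_block_arnoldi A\<^sup>T C\<^sup>T m V \<Lambda> H" "without_breakdown A\<^sup>T C\<^sup>T m H"
    and Vm: "Vm = arnoldi_basis n m V"
    and Tm: "Tm = Vm\<^sup>T * A\<^sup>T * Vm"
    and Bm: "Bm = Vm\<^sup>T * B"
    and Cm: "Cm = C * Vm"
    and Y_dim: "\<And>t. t \<in> {0..T_f} \<Longrightarrow> Y t \<in> carrier_mat (2 * m * s) (2 * m * s)"
    and Y_diff: "\<And>t. t \<in> {0..T_f} \<Longrightarrow> mat_differentiable Y t {0..T_f}"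
    and Y_ode: "\<And>t. t \<in> {0..T_f} \<Longrightarrow>
      mat_derivative Y t {0..T_f} - Tm * Y t - Y t * Tm\<^sup>T + Y t * Bm * Bm\<^sup>T * Y t - Cm\<^sup>T * Cm
        = 0\<^sub>m (2 * m * s) (2 * m * s)"
    and Xm: "\<And>t. Xm t = Vm * Y t * Vm\<^sup>T"
    and E: "\<And>t. E t = X t - Xm t"
    and R: "\<And>t. R t = mat_derivative Xm t {0..T_f} - A\<^sup>T * Xm t - Xm t * A
      + Xm t * B * B\<^sup>T * Xm t - C\<^sup>T * C"
  shows "\<forall>t\<in>{0..T_f}. has_mat_derivative E
    ((A\<^sup>T - X t * B * B\<^sup>T) * E t + E t * (A - B * B\<^sup>T * X t) + E t * B * B\<^sup>T * E t - R t)
    t {0..T_f}"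
proof
  fix t assume t: "t \<in> {0..T_f}"
  have basis: "Vm \<in> carrier_mat n (2 * m * s)"
  proof -
    have "A\<^sup>T \<in> carrier_mat n n" "C\<^sup>T \<in> carrier_mat n s"
      using A(1) C(1) by auto
    then have "V j \<in> carrier_mat n (2 * s)" if "1 \<le> j" "j \<le> m" for j
      using extended_block_arnoldi_carrier[OF _ _ arnoldi(1)] that by simp
    then have "Vm \<in> carrier_mat n (m * (2 * s))"
      unfolding Vm by (rule arnoldi_basis_carrier)
    then show ?thesis
      by (simp only: mult.assoc mult.left_commute)
  qed
  obtain D where D: "has_mat_derivative Y D t {0..T_f}"
    using Y_diff[OF t] unfolding mat_differentiable_def by blast
  \<comment> \<open>The derivative relation forces \<open>Y t\<close> to have the size of
    \<open>D\<close>; comparing at \<open>t\<close> fixes that size.\<close>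
  then have D_dim: "D \<in> carrier_mat (2 * m * s) (2 * m * s)"
    using Y_dim[OF t] t unfolding has_mat_derivative_def
    by (metis carrier_matD carrier_matI)
  define D' where "D' = Vm * D * Vm\<^sup>T"
  have D'_dim: "D' \<in> carrier_mat n n"
    using basis unfolding D'_def by auto
  have Xm_deriv: "has_mat_derivative Xm D' t {0..T_f}"
    using has_mat_derivative_congruence[OF D t D_dim basis] unfolding D'_def Xm[abs_def] .
  \<comment> \<open>As \<open>T_f > 0\<close>, the interval is nondegenerate and the derivative in
    the residual is \<open>D'\<close>.\<close>
  have R_t: "R t = D' - A\<^sup>T * Xm t - Xm t * A + Xm t * B * B\<^sup>T * Xm t - C\<^sup>T * C"
    unfolding R mat_derivative_eq[OF T_f t Xm_deriv] ..
  have Xm_dim: "Xm t \<in> carrier_mat n n"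
    using basis unfolding Xm by auto
  have K: "C\<^sup>T * C \<in> carrier_mat n n"
    using C(1) by auto
  \<comment> \<open>The Riccati right-hand side minus \<open>D'\<close> is the left side of the
    algebraic identity, which then rewrites it into the claimed form.\<close>
  have "has_mat_derivative E
      ((A\<^sup>T * X t + X t * A - X t * B * B\<^sup>T * X t + C\<^sup>T * C) - D') t {0..T_f}"
    unfolding E[abs_def]
    using has_mat_derivative_minus[OF X_ode[OF t] Xm_deriv t _ D'_dim] K by auto
  then show "has_mat_derivative E
    ((A\<^sup>T - X t * B * B\<^sup>T) * E t + E t * (A - B * B\<^sup>T * X t) + E t * B * B\<^sup>T * E t - R t)
    t {0..T_f}"
    unfolding riccati_error_identity[OF A(1) B(1) X_dim[OF t] Xm_dim D'_dim K] E R_t .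
qed

end
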